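(* For every partition $\lambda=(\lambda_1\ge\dots\ge\lambda_n\ge0)$, the Koornwinder moment at $q=\xi=1$ is $$K_\lambda=S^{|\lambda|}\prod_{z\in\lambda}(x+h(z)-1)\cdot\prod_{i=1}^{n-1}\prod_{j=i+1}^n\frac{(x+\lambda_i-\lambda_j+j-i-1)(\lambda_i-\lambda_j+j-i)}{(x+j-i-1)(j-i)}.$$
   Context: Let $\alpha,\beta,\gamma,\delta$ be positive reals with $\alpha\beta\ne\gamma\delta$ (or generic parameters). Put $x=\frac{\alpha+\beta+\gamma+\delta}{(\alpha+\gamma)(\beta+\delta)}$ and $S=\frac{(\alpha+\gamma)(\beta+\delta)}{\alpha\beta-\gamma\delta}$. Let $\mathcal D,\mathcal E$ be infinite tridiagonal matrices indexed by $\{0,1,\dots\}$ with entries $\mathcal D_{n,n}=\frac{\alpha+\delta+n(\alpha\beta+2\alpha\delta+\gamma\delta)}{(\alpha+\gamma)(\beta+\delta)}$, $\mathcal E_{n,n}=\frac{\beta+\gamma+n(\alpha\beta+2\beta\gamma+\gamma\delta)}{(\alpha+\gamma)(\beta+\delta)}$, $\mathcal D_{n,n+1}=\frac{\alpha}{\alpha+\gamma}[(n+1)(x+n)]^{1/2}$, $\mathcal E_{n,n+1}=\frac{\gamma}{\alpha+\gamma}[(n+1)(x+n)]^{1/2}$, $\mathcal D_{n+1,n}=\frac{\delta}{\beta+\delta}[(n+1)(x+n)]^{1/2}$, $\mathcal E_{n+1,n}=\frac{\beta}{\beta+\delta}[(n+1)(x+n)]^{1/2}$, all other entries $0$. With $\langle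 W|=(1,0,0,\dots)$ and $|V\rangle=\langle W|^T$, set $Z_N=S^N\langle W|(\mathcal D+\mathcal E)^N|V\rangle$. For a partition $\lambda$ with $n$ parts, $K_\lambda=\frac{\det(Z_{\lambda_i+n-i+n-j})_{i,j=1}^n}{\det(Z_{2n-i-j})_{i,j=1}^n}$. $|\lambda|=\sum_i\lambda_i$. The Young diagram of $\lambda$ is the left-justified array with $\lambda_i$ cells in row $i$; for a cell $z=(i,j)$ its hook length $h(z)$ is the number of cells $(a,b)$ with $a=i,b\ge j$ or $a\ge i,b=j$. *)

theory Defs
  imports Complex_Main "HOL-Library.Groups_Big_Fun" "Jordan_Normal_Form.Determinant"
begin

text \<open>
  Everything is stated over a field of characteristic zero, with the square root function
  \<open>rt\<close> as a parameter: it is \<open>sqrt\<close> for real and \<open>csqrt\<close> for complex parameters.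
\<close>

definition x_par :: "'a::field \<Rightarrow> 'a \<Rightarrow> 'a \<Rightarrow> 'a \<Rightarrow> 'a" where
  "x_par \<alpha> \<beta> \<gamma> \<delta> = (\<alpha> + \<beta> + \<gamma> + \<delta>) / ((\<alpha> + \<gamma>) * (\<beta> + \<delta>))"

definition S_par :: "'a::field \<Rightarrow> 'a \<Rightarrow> 'a \<Rightarrow> 'a \<Rightarrow> 'a" where
  "S_par \<alpha> \<beta> \<gamma> \<delta> = ((\<alpha> + \<gamma>) * (\<beta> + \<delta>)) / (\<alpha> * \<beta> - \<gamma> * \<delta>)"

type_synonym 'a infmat = "nat \<Rightarrow> nat \<Rightarrow> 'a"

definition matD :: "('a::field_char_0 \<Rightarrow> 'a) \<Rightarrow> 'a \<Rightarrow> 'a \<Rightarrow> 'a \<Rightarrow> 'a \<Rightarrow> 'a infmat" where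
  "matD rt \<alpha> \<beta> \<gamma> \<delta> i j =
     (if j = i then
        (\<alpha> + \<delta> + of_nat i * (\<alpha> * \<beta> + 2 * \<alpha> * \<delta> + \<gamma> * \<delta>)) / ((\<alpha> + \<gamma>) * (\<beta> + \<delta>))
      else if j = i + 1 then
        \<alpha> / (\<alpha> + \<gamma>) * rt ((of_nat i + 1) * (x_par \<alpha> \<beta> \<gamma> \<delta> + of_nat i))
      else if i = j + 1 then
        \<delta> / (\<beta> + \<delta>) * rt ((of_nat j + 1) * (x_par \<alpha> \<beta> \<gamma> \<delta> + of_nat j))
      else 0)"

definition matE :: "('a::field_char_0 \<Rightarrow> 'a) \<Rightarrow> 'a \<Rightarrow> 'a \<Rightarrow> 'a \<Rightarrow> 'a \<Rightarrow> 'a infmat" where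
  "matE rt \<alpha> \<beta> \<gamma> \<delta> i j =
     (if j = i then
        (\<beta> + \<gamma> + of_nat i * (\<alpha> * \<beta> + 2 * \<beta> * \<gamma> + \<gamma> * \<delta>)) / ((\<alpha> + \<gamma>) * (\<beta> + \<delta>))
      else if j = i + 1 then
        \<gamma> / (\<alpha> + \<gamma>) * rt ((of_nat i + 1) * (x_par \<alpha> \<beta> \<gamma> \<delta> + of_nat i))
      else if i = j + 1 then
        \<beta> / (\<beta> + \<delta>) * rt ((of_nat j + 1) * (x_par \<alpha> \<beta> \<gamma> \<delta> + of_nat j))
      else 0)"

text \<open>
  \<^const>\<open>Sum_any\<close> sums over the support of its argument, which is finite whenever the
  left factor is row-finite; this is the case for all matrices used here, as powers of
  tridiagonal matrices are banded.
\<close>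

definition infmat_add :: "'a::comm_ring_1 infmat \<Rightarrow> 'a infmat \<Rightarrow> 'a infmat" where
  "infmat_add A B = (\<lambda>i j. A i j + B i j)"

definition infmat_mult :: "'a::comm_ring_1 infmat \<Rightarrow> 'a infmat \<Rightarrow> 'a infmat" where
  "infmat_mult A B = (\<lambda>i j. Sum_any (\<lambda>k. A i k * B k j))"

fun infmat_pow :: "'a::comm_ring_1 infmat \<Rightarrow> nat \<Rightarrow> 'a infmat" where
  "infmat_pow A 0 = (\<lambda>i j. if i = j then 1 else 0)"
| "infmat_pow A (Suc N) = infmat_mult A (infmat_pow A N)"

definition sandwich :: "(nat \<Rightarrow> 'a::comm_ring_1) \<Rightarrow> 'a infmat \<Rightarrow> (nat \<Rightarrow> 'a) \<Rightarrow> 'a" where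
  "sandwich w A v = Sum_any (\<lambda>i. Sum_any (\<lambda>j. w i * A i j * v j))"

definition vecW :: "nat \<Rightarrow> 'a::comm_ring_1" where
  "vecW i = (if i = 0 then 1 else 0)"

definition vecV :: "nat \<Rightarrow> 'a::comm_ring_1" where
  "vecV = vecW"

definition Z_fun :: "('a::field_char_0 \<Rightarrow> 'a) \<Rightarrow> 'a \<Rightarrow> 'a \<Rightarrow> 'a \<Rightarrow> 'a \<Rightarrow> nat \<Rightarrow> 'a" where
  "Z_fun rt \<alpha> \<beta> \<gamma> \<delta> N =
     S_par \<alpha> \<beta> \<gamma> \<delta> ^ N *
     sandwich vecW (infmat_pow (infmat_add (matD rt \<alpha> \<beta> \<gamma> \<delta>) (matE rt \<alpha> \<beta> \<gamma> \<delta>)) N) vecV"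

text \<open>
  A partition with \<open>n\<close> (possibly zero) parts is given by the values
  \<open>lam 1 \<ge> \<dots> \<ge> lam n\<close>; values of \<open>lam\<close> outside \<open>{1..n}\<close> are irrelevant.
\<close>

definition is_partition :: "nat \<Rightarrow> (nat \<Rightarrow> nat) \<Rightarrow> bool" where
  "is_partition n lam \<longleftrightarrow> (\<forall>i j. 1 \<le> i \<and> i \<le> j \<and> j \<le> n \<longrightarrow> lam j \<le> lam i)"

definition part_size :: "nat \<Rightarrow> (nat \<Rightarrow> nat) \<Rightarrow> nat" where
  "part_size n lam = (\<Sum>i=1..n. lam i)"

definition young :: "nat \<Rightarrow> (nat \<Rightarrow> nat) \<Rightarrow> (nat \<times> nat) set" where
  "young n lam = {(i, j). 1 \<le> i \<and> i \<le> n \<and> 1 \<le> j \<and> j \<le> lam i}"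

definition hook :: "nat \<Rightarrow> (nat \<Rightarrow> nat) \<Rightarrow> nat \<times> nat \<Rightarrow> nat" where
  "hook n lam z = card {(a, b) \<in> young n lam.
     (a = fst z \<and> b \<ge> snd z) \<or> (a \<ge> fst z \<and> b = snd z)}"

text \<open>
  Rows and columns of \<^const>\<open>mat\<close> are numbered from \<open>0\<close>, so \<open>Suc i\<close> and \<open>Suc j\<close>
  are the usual indices in \<open>{1..n}\<close>; no subtraction below is truncated.
\<close>

definition K_fun ::
  "('a::field_char_0 \<Rightarrow> 'a) \<Rightarrow> 'a \<Rightarrow> 'a \<Rightarrow> 'a \<Rightarrow> 'a \<Rightarrow> nat \<Rightarrow> (nat \<Rightarrow> nat) \<Rightarrow> 'a" where
  "K_fun rt \<alpha> \<beta> \<gamma> \<delta> n lam =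
     det (mat n n (\<lambda>(i, j). Z_fun rt \<alpha> \<beta> \<gamma> \<delta> (lam (Suc i) + (n - Suc i) + (n - Suc j)))) /
     det (mat n n (\<lambda>(i, j). Z_fun rt \<alpha> \<beta> \<gamma> \<delta> ((n - Suc i) + (n - Suc j))))"

end

theory Submission
  imports Defs
begin

text \<open>
  The matrix \<open>D + E\<close> is the Jacobi matrix of the Laguerre polynomials, with diagonal \<open>x + 2n\<close> and
  squared off-diagonal entries \<open>(n+1)(x+n)\<close>, so \<open>Z\<^sub>N\<close> is \<open>S\<^sup>N\<close> times the rising factorial
  \<open>x(x+1)\<dots>(x+N-1)\<close>. With \<open>l\<^sub>i = \<lambda>\<^sub>i + n - i\<close>, the determinants in \<open>K\<^sub>\<lambda>\<close> therefore
  reduce to Vandermonde determinants in the \<open>x + l\<^sub>i\<close>. The remaining factor, the ratio of rising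
  factorials of lengths \<open>l\<^sub>i\<close> and \<open>n - i\<close>, is a product over hooks because the hook lengths in
  row \<open>i\<close> are the complement of \<open>{l\<^sub>i - l\<^sub>j | j > i}\<close> in \<open>{1..l\<^sub>i}\<close>.
\<close>

section \<open>Moments\<close>

lemma infmat_mult_tridiagonal:
  fixes M B :: "'a::comm_ring_1 infmat"
  assumes "\<And>i k. M i k \<noteq> 0 \<Longrightarrow> k \<le> Suc i \<and> i \<le> Suc k"
  shows "infmat_mult M B i j =
    M i i * B i j + M i (Suc i) * B (Suc i) j + (if i = 0 then 0 else M i (i - 1) * B (i - 1) j)"
proof -
  have "k \<in> {i - 1..Suc i}" if "M i k * B k j \<noteq> 0" for k
  proof -
    have "M i k \<noteq> 0" using that by auto
    from assms[OF this] show ?thesis by auto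
  qed
  then have "infmat_mult M B i j = (\<Sum>k\<in>{i - 1..Suc i}. M i k * B k j)"
    unfolding infmat_mult_def by (intro Sum_any.expand_superset) blast+
  then show ?thesis
    by (cases i) (simp_all add: atLeastAtMostSuc_conv algebra_simps)
qed

text \<open>
  The entry \<open>(i, 0)\<close> of the \<open>N\<close>-th power is the \<open>N\<close>-th moment of the normalised
  Laguerre polynomial of degree \<open>i\<close>.
\<close>

lemma laguerre_jacobi_power:
  fixes M :: "'a::field_char_0 infmat"
  assumes M: "\<And>i j. M i j = (if j = i then x + 2 * of_nat i else if j = i + 1 then r i
      else if i = j + 1 then r j else 0)"
    and r_sq: "\<And>k. r k * r k = (of_nat k + 1) * (x + of_nat k)"
    and r_nz: "\<And>k. r k \<noteq> 0"
  shows "infmat_pow M N i 0 =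
    (\<Prod>k<i. of_nat N - of_nat k) * pochhammer x N / (\<Prod>k<i. r k)"
proof (induction N arbitrary: i)
  case 0
  show ?case by (cases i) (simp_all add: lessThan_Suc_eq_insert_0)
next
  case (Suc N)
  have band: "k \<le> Suc i \<and> i \<le> Suc k" if "M i k \<noteq> 0" for i k
    using that by (auto simp: M split: if_splits)
  have step: "infmat_pow M (Suc N) i 0 = (x + 2 * of_nat i) * infmat_pow M N i 0
      + r i * infmat_pow M N (Suc i) 0 + (if i = 0 then 0 else r (i - 1) * infmat_pow M N (i - 1) 0)" for i
    using M[of i i] M[of i "Suc i"] M[of i "i - 1"]
    by (cases i) (simp_all add: infmat_mult_tridiagonal[OF band])
  show ?case
  proof (cases i)
    case 0
    then show ?thesis
      by (simp add: step Suc.IH r_nz pochhammer_Suc algebra_simps del: infmat_pow.simps)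
  next
    case (Suc m)
    define f :: 'a where "f = (\<Prod>k<m. of_nat N - of_nat k)"
    define R where "R = (\<Prod>k<m. r k)"
    define P where "P = pochhammer x N"
    have nz: "R \<noteq> 0" "r m \<noteq> 0" "r (Suc m) \<noteq> 0"
      using r_nz by (auto simp: R_def)
    have shift: "(\<Prod>k<Suc m. of_nat (Suc N) - of_nat k :: 'a) = (of_nat N + 1) * f"
      unfolding f_def prod.lessThan_Suc_shift by (simp add: algebra_simps)
    have "infmat_pow M (Suc N) i 0 =
        (x + 2 * of_nat (Suc m)) * (f * (of_nat N - of_nat m) * P / (R * r m))
        + r (Suc m) * (f * (of_nat N - of_nat m) * (of_nat N - of_nat (Suc m)) * P / (R * r m * r (Suc m)))
        + r m * (f * P / R)"
      by (simp add: step Suc Suc.IH f_def R_def P_def del: infmat_pow.simps)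
    also have "\<dots> = f * P / (R * r m) * ((x + 2 * of_nat (Suc m)) * (of_nat N - of_nat m)
        + (of_nat N - of_nat m) * (of_nat N - of_nat (Suc m)) + r m * r m)"
      using nz by (simp add: field_simps)
    also have "\<dots> = f * P / (R * r m) * ((of_nat N + 1) * (x + of_nat N))"
      unfolding r_sq by (rule arg_cong[where f = "(*) _"]) (simp add: algebra_simps)
    also have "\<dots> = (\<Prod>k<i. of_nat (Suc N) - of_nat k) * pochhammer x (Suc N) / (\<Prod>k<i. r k)"
      unfolding Suc shift by (simp add: pochhammer_Suc R_def P_def)
    finally show ?thesis .
  qed
qed

lemma sandwich_vecW_vecV: "sandwich vecW A vecV = A 0 0"
proof -
  have "sandwich vecW A vecV = (\<Sum>i\<in>{0}. Sum_any (\<lambda>j. vecW i * A i j * vecV j))"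
    unfolding sandwich_def
    by (rule Sum_any.expand_superset) (auto simp: vecW_def split: if_splits)
  also have "\<dots> = (\<Sum>i\<in>{0}. \<Sum>j\<in>{0}. vecW i * A i j * vecV j)"
    by (intro sum.cong refl Sum_any.expand_superset)
      (auto simp: vecW_def vecV_def split: if_splits)
  finally show ?thesis by (simp add: vecW_def vecV_def)
qed

lemma Z_fun_eq_pochhammer:
  fixes \<alpha> \<beta> \<gamma> \<delta> :: "'a::field_char_0"
  defines "x \<equiv> x_par \<alpha> \<beta> \<gamma> \<delta>"
  assumes nz: "\<alpha> + \<gamma> \<noteq> 0" "\<beta> + \<delta> \<noteq> 0"
    and x_nz: "\<And>k::nat. x + of_nat k \<noteq> 0"
    and rt: "\<And>k::nat. let y = (of_nat k + 1) * (x + of_nat k) in rt y * rt y = y"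
  shows "Z_fun rt \<alpha> \<beta> \<gamma> \<delta> N = S_par \<alpha> \<beta> \<gamma> \<delta> ^ N * pochhammer x N"
proof -
  define r where "r k = rt ((of_nat k + 1) * (x + of_nat k))" for k :: nat
  define M where "M = infmat_add (matD rt \<alpha> \<beta> \<gamma> \<delta>) (matE rt \<alpha> \<beta> \<gamma> \<delta>)"
  have r_sq: "r k * r k = (of_nat k + 1) * (x + of_nat k)" for k
    using rt by (simp add: r_def Let_def)
  have "(1 + of_nat k :: 'a) \<noteq> 0" for k
    using of_nat_neq_0[of k] by (simp only: of_nat_Suc not_False_eq_True)
  then have r_nz: "r k \<noteq> 0" for k
    using r_sq[of k] x_nz[of k] by (auto simp: add.commute)
  have c1: "\<alpha> / (\<alpha> + \<gamma>) * t + \<gamma> / (\<alpha> + \<gamma>) * t = t" for t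
    using nz by (metis add_divide_distrib distrib_right divide_self mult_1)
  have c2: "\<delta> / (\<beta> + \<delta>) * t + \<beta> / (\<beta> + \<delta>) * t = t" for t
    using nz by (metis add.commute add_divide_distrib distrib_right divide_self mult_1)
  have diag: "(\<alpha> + \<delta> + t * (\<alpha> * \<beta> + 2 * \<alpha> * \<delta> + \<gamma> * \<delta>)) / ((\<alpha> + \<gamma>) * (\<beta> + \<delta>))
      + (\<beta> + \<gamma> + t * (\<alpha> * \<beta> + 2 * \<beta> * \<gamma> + \<gamma> * \<delta>)) / ((\<alpha> + \<gamma>) * (\<beta> + \<delta>)) = x + 2 * t" for t
  proof -
    have "x + 2 * t = ((\<alpha> + \<beta> + \<gamma> + \<delta>) + 2 * t * ((\<alpha> + \<gamma>) * (\<beta> + \<delta>))) / ((\<alpha> + \<gamma>) * (\<beta> + \<delta>))"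
      using nz by (simp add: x_def x_par_def add_divide_distrib)
    then show ?thesis
      unfolding add_divide_distrib[symmetric] by (simp add: algebra_simps)
  qed
  have M: "M i j = (if j = i then x + 2 * of_nat i else if j = i + 1 then r i
      else if i = j + 1 then r j else 0)" for i j
    by (simp add: M_def infmat_add_def matD_def matE_def diag c1 c2 r_def x_def[symmetric]
        del: times_divide_eq_left)
  have "infmat_pow M N 0 0 = pochhammer x N"
    using laguerre_jacobi_power[of M x r N 0, OF M r_sq r_nz] by simp
  then show ?thesis
    by (simp add: Z_fun_def sandwich_vecW_vecV M_def)
qed

section \<open>Determinants\<close>

lemma prod_list_diag_mat:
  "A \<in> carrier_mat n n \<Longrightarrow> prod_list (diag_mat A) = (\<Prod>i<n. A $$ (i, i))"
  by (auto simp: prod_list_diag_prod atLeast0LessThan)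

lemma det_mat_scale_rows_cols:
  fixes A :: "nat \<Rightarrow> nat \<Rightarrow> 'a::comm_ring_1"
  shows "det (mat n n (\<lambda>(i, j). c i * d j * A i j)) =
    (\<Prod>i<n. c i) * (\<Prod>j<n. d j) * det (mat n n (\<lambda>(i, j). A i j))"
proof -
  have "(\<Prod>i=0..<n. c i * d (p i) * A i (p i)) =
      (\<Prod>i<n. c i) * (\<Prod>j<n. d j) * (\<Prod>i=0..<n. A i (p i))"
    if "p permutes {0..<n}" for p
    using prod.permute[OF that, of d]
    by (simp add: prod.distrib atLeast0LessThan comp_def)
  then have "signof p * (\<Prod>i=0..<n. mat n n (\<lambda>(i, j). c i * d j * A i j) $$ (i, p i)) =
      (\<Prod>i<n. c i) * (\<Prod>j<n. d j) *
      (signof p * (\<Prod>i=0..<n. mat n n (\<lambda>(i, j). A i j) $$ (i, p i)))"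
    if "p permutes {0..<n}" for p
    using that permutes_in_image[OF that] by (simp add: mult_ac)
  then show ?thesis
    by (simp only: det_def'[OF mat_carrier] sum_distrib_left) (intro sum.cong refl, simp)
qed

text \<open>
  All monic families give the same determinant as the monomials; for the Newton basis with the
  nodes \<open>y\<close> themselves the matrix is triangular.
\<close>

lemma det_monic_polys:
  fixes y :: "nat \<Rightarrow> 'a::idom"
  assumes deg: "\<And>j. j < n \<Longrightarrow> degree (q j) = n - Suc j"
    and monic: "\<And>j. j < n \<Longrightarrow> lead_coeff (q j) = 1"
  shows "det (mat n n (\<lambda>(i, j). poly (q j) (y i))) = (\<Prod>i<n. \<Prod>k\<in>{Suc i..<n}. y i - y k)"
proof -
  define V where "V = mat n n (\<lambda>(i, k). y i ^ (n - Suc k))"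
  have indep: "det (mat n n (\<lambda>(i, j). poly (p j) (y i))) = det V"
    if p: "\<And>j. j < n \<Longrightarrow> degree (p j) = n - Suc j" "\<And>j. j < n \<Longrightarrow> lead_coeff (p j) = 1" for p
  proof -
    define U where "U = mat n n (\<lambda>(k, j). coeff (p j) (n - Suc k))"
    have eval: "poly (p j) t = (\<Sum>k<n. t ^ (n - Suc k) * coeff (p j) (n - Suc k))"
      if "j < n" for j t
    proof -
      have "poly (p j) t = (\<Sum>k\<le>degree (p j). coeff (p j) k * t ^ k)"
        by (rule poly_altdef)
      also have "\<dots> = (\<Sum>k<n. coeff (p j) k * t ^ k)"
        using that p(1)[OF that] by (intro sum.mono_neutral_left) (auto simp: coeff_eq_0)
      also have "\<dots> = (\<Sum>k<n. coeff (p j) (n - Suc k) * t ^ (n - Suc k))"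
        by (rule sum.nat_diff_reindex[symmetric])
      finally show ?thesis by (simp add: mult.commute)
    qed
    have "mat n n (\<lambda>(i, j). poly (p j) (y i)) = V * U"
      by (rule eq_matI) (auto simp: V_def U_def eval scalar_prod_def atLeast0LessThan)
    moreover have "det U = (\<Prod>i<n. U $$ (i, i))"
    proof -
      have "det U = prod_list (diag_mat U)"
        by (rule det_lower_triangular[of n])
          (use p(1) in \<open>auto simp: U_def intro!: coeff_eq_0\<close>)
      then show ?thesis by (simp add: prod_list_diag_mat[of _ n] U_def)
    qed
    moreover have "U $$ (i, i) = 1" if "i < n" for i
      using that p(1)[OF that] p(2)[OF that] by (simp add: U_def)
    moreover have "V \<in> carrier_mat n n" "U \<in> carrier_mat n n"
      by (simp_all add: V_def U_def)
    ultimately show ?thesis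
      by (simp add: det_mult)
  qed
  define w where "w j = (\<Prod>k\<in>{Suc j..<n}. [:- y k, 1:])" for j
  have "degree (w j) = n - Suc j" "lead_coeff (w j) = 1" for j
    unfolding w_def by (subst degree_prod_eq_sum_degree; simp) (subst lead_coeff_prod; simp)
  then have "det V = det (mat n n (\<lambda>(i, j). poly (w j) (y i)))"
    by (simp add: indep)
  also have "\<dots> = prod_list (diag_mat (mat n n (\<lambda>(i, j). poly (w j) (y i))))"
    by (rule det_upper_triangular[of _ n]) (auto simp: w_def poly_prod intro!: upper_triangularI prod_zero bexI)
  also have "\<dots> = (\<Prod>i<n. \<Prod>k\<in>{Suc i..<n}. y i - y k)"
    by (simp add: prod_list_diag_mat[of _ n] w_def poly_prod)
  finally show ?thesis
    using indep[OF deg monic] by simp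
qed

lemma det_power_mult_pochhammer:
  fixes x s :: "'a::field_char_0" and l :: "nat \<Rightarrow> nat"
  shows "det (mat n n (\<lambda>(i, j). s ^ (l i + (n - Suc j)) * pochhammer x (l i + (n - Suc j)))) =
    (\<Prod>i<n. s ^ l i * pochhammer x (l i)) * (\<Prod>j<n. s ^ (n - Suc j)) *
    (\<Prod>i<n. \<Prod>k\<in>{Suc i..<n}. of_nat (l i) - of_nat (l k))"
proof -
  define q :: "nat \<Rightarrow> 'a poly" where "q j = (\<Prod>k<n - Suc j. [:of_nat k, 1:])" for j
  have q: "degree (q j) = n - Suc j" "lead_coeff (q j) = 1" for j
    unfolding q_def by (subst degree_prod_eq_sum_degree; simp) (subst lead_coeff_prod; simp)
  have poly_q: "poly (q j) t = pochhammer t (n - Suc j)" for j t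
    by (simp add: q_def poly_prod pochhammer_prod atLeast0LessThan add.commute)
  have "s ^ (l i + (n - Suc j)) * pochhammer x (l i + (n - Suc j)) =
      s ^ l i * pochhammer x (l i) * s ^ (n - Suc j) * poly (q j) (x + of_nat (l i))" for i j
    by (simp add: poly_q power_add pochhammer_product'[of x "l i" "n - Suc j"] mult_ac)
  then show ?thesis
    by (simp add: det_mat_scale_rows_cols det_monic_polys[of n q, OF q])
qed

section \<open>Hook lengths\<close>

lemma hook_eq:
  assumes part: "is_partition n lam" and i: "1 \<le> i" "i \<le> n" and j: "1 \<le> j" "j \<le> lam i"
  shows "\<exists>m. i \<le> m \<and> m \<le> n \<and> (\<forall>k\<in>{1..n}. j \<le> lam k \<longleftrightarrow> k \<le> m) \<and>
    hook n lam (i, j) = lam i - j + (m - i) + 1"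
proof -
  define m where "m = Max {k \<in> {1..n}. j \<le> lam k}"
  have fin: "finite {k \<in> {1..n}. j \<le> lam k}" by simp
  have "i \<in> {k \<in> {1..n}. j \<le> lam k}" using i j by simp
  then have m: "m \<in> {k \<in> {1..n}. j \<le> lam k}" and im: "i \<le> m"
    using Max_in[OF fin] Max_ge[OF fin] unfolding m_def by blast+
  have col: "j \<le> lam k \<longleftrightarrow> k \<le> m" if k: "1 \<le> k" "k \<le> n" for k
  proof
    show "k \<le> m" if "j \<le> lam k"
      using Max_ge[OF fin, of k] that k unfolding m_def by simp
    show "j \<le> lam k" if "k \<le> m"
      using part k that m unfolding is_partition_def by (auto intro: le_trans)
  qed
  have "{(a, b) \<in> young n lam. (a = i \<and> b \<ge> j) \<or> (a \<ge> i \<and> b = j)} =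
      ({i} \<times> {j..lam i}) \<union> ({Suc i..m} \<times> {j})"
    using i j m im col by (auto simp: young_def Suc_le_eq)
  moreover have "card (({i} \<times> {j..lam i}) \<union> ({Suc i..m} \<times> {j})) = (Suc (lam i) - j) + (m - i)"
    by (subst card_Un_disjoint) (auto simp: card_cartesian_product)
  ultimately have "hook n lam (i, j) = lam i - j + (m - i) + 1"
    using j by (simp add: hook_def)
  then show ?thesis using im m col by auto
qed

lemma pochhammer_eq_prod_hooks:
  fixes x :: "'a::field_char_0"
  assumes part: "is_partition n lam" and i: "1 \<le> i" "i \<le> n"
  defines "L \<equiv> \<lambda>k. lam k + (n - k)"
  shows "pochhammer x (L i) = (\<Prod>j=1..lam i. x + of_nat (hook n lam (i, j)) - 1) *
    (\<Prod>k=i+1..n. x + of_nat (L i - L k) - 1)"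
proof -
  define H where "H j = hook n lam (i, j)" for j
  define D where "D k = L i - L k" for k
  have lam_mono: "lam b \<le> lam a" if "1 \<le> a" "a \<le> b" "b \<le> n" for a b
    using part that unfolding is_partition_def by blast
  have D: "D k = lam i - lam k + (k - i)" if "i < k" "k \<le> n" for k
    using lam_mono[of i k] that i by (simp add: D_def L_def)
  have H_anti: "H j' < H j" if "1 \<le> j" "j < j'" "j' \<le> lam i" for j j'
  proof -
    obtain m where m: "i \<le> m" "m \<le> n" "\<forall>k\<in>{1..n}. j \<le> lam k \<longleftrightarrow> k \<le> m"
      "H j = lam i - j + (m - i) + 1"
      using hook_eq[OF part i, of j] \<open>1 \<le> j\<close> \<open>j < j'\<close> \<open>j' \<le> lam i\<close>
      unfolding H_def by (meson less_imp_le le_trans)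
    obtain m' where m': "i \<le> m'" "m' \<le> n" "\<forall>k\<in>{1..n}. j' \<le> lam k \<longleftrightarrow> k \<le> m'"
      "H j' = lam i - j' + (m' - i) + 1"
      using hook_eq[OF part i, of j'] \<open>1 \<le> j\<close> \<open>j < j'\<close> \<open>j' \<le> lam i\<close>
      unfolding H_def by (meson less_imp_le le_trans)
    have "m' \<le> m" using m(3)[rule_format, of m'] m'(1,2) m'(3)[rule_format, of m'] i that by simp
    then show ?thesis using m m' that by simp
  qed
  have H_inj: "inj_on H {1..lam i}"
    by (rule inj_onI) (metis H_anti atLeastAtMost_iff less_irrefl linorder_neqE_nat)
  have D_inj: "inj_on D {i+1..n}"
  proof (rule linorder_inj_onI)
    fix a b assume "a < b" "a \<in> {i+1..n}" "b \<in> {i+1..n}"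
    then show "D a \<noteq> D b"
      using D[of a] D[of b] lam_mono[of a b] lam_mono[of i a] i by simp
  qed auto
  have disj: "H ` {1..lam i} \<inter> D ` {i+1..n} = {}"
  proof -
    have "H j \<noteq> D k" if j: "1 \<le> j" "j \<le> lam i" and k: "i < k" "k \<le> n" for j k
    proof -
      obtain m where m: "i \<le> m" "m \<le> n" "\<forall>k\<in>{1..n}. j \<le> lam k \<longleftrightarrow> k \<le> m"
        "H j = lam i - j + (m - i) + 1"
        using hook_eq[OF part i j] unfolding H_def by blast
      show ?thesis
        using m(1,4) m(3)[rule_format, of k] D[OF k] lam_mono[of i k] i j k by (cases "k \<le> m") simp_all
    qed
    then show ?thesis by force
  qed
  have "H j \<in> {1..L i}" if "j \<in> {1..lam i}" for j
    using that hook_eq[OF part i, of j] by (auto simp: H_def L_def)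
  moreover have "D k \<in> {1..L i}" if "k \<in> {i+1..n}" for k
    using that D[of k] by (auto simp: L_def)
  ultimately have "H ` {1..lam i} \<union> D ` {i+1..n} \<subseteq> {1..L i}" by blast
  moreover have "card (H ` {1..lam i} \<union> D ` {i+1..n}) = card {1..L i}"
    unfolding card_Un_disjoint[OF finite_imageI[OF finite_atLeastAtMost]
        finite_imageI[OF finite_atLeastAtMost] disj] card_image[OF H_inj] card_image[OF D_inj]
    by (simp add: L_def)
  ultimately have "{1..L i} = H ` {1..lam i} \<union> D ` {i+1..n}"
    by (intro card_subset_eq[symmetric]) auto
  moreover have "pochhammer x (L i) = (\<Prod>h\<in>{1..L i}. x + of_nat h - 1)"
    by (simp add: pochhammer_prod prod.atLeast1_atMost_eq atLeast0LessThan)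
  ultimately have "pochhammer x (L i) = (\<Prod>h\<in>H ` {1..lam i} \<union> D ` {i+1..n}. x + of_nat h - 1)"
    by simp
  also have "\<dots> = (\<Prod>h\<in>H ` {1..lam i}. x + of_nat h - 1) * (\<Prod>h\<in>D ` {i+1..n}. x + of_nat h - 1)"
    by (rule prod.union_disjoint) (use disj in auto)
  also have "\<dots> = (\<Prod>j=1..lam i. x + of_nat (H j) - 1) * (\<Prod>k=i+1..n. x + of_nat (D k) - 1)"
    by (simp only: prod.reindex[OF H_inj] prod.reindex[OF D_inj] comp_def)
  finally show ?thesis by (simp add: H_def D_def)
qed

lemma K_fun_eq_hook_product:
  fixes \<alpha> \<beta> \<gamma> \<delta> :: "'a::field_char_0" and lam :: "nat \<Rightarrow> nat"
  defines "x \<equiv> x_par \<alpha> \<beta> \<gamma> \<delta>" and "S \<equiv> S_par \<alpha> \<beta> \<gamma> \<delta>"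
  assumes part: "is_partition n lam"
    and nz: "\<alpha> + \<gamma> \<noteq> 0" "\<beta> + \<delta> \<noteq> 0" "\<alpha> * \<beta> \<noteq> \<gamma> * \<delta>"
    and x_nz: "\<And>k::nat. x + of_nat k \<noteq> 0"
    and rt: "\<And>k::nat. let y = (of_nat k + 1) * (x + of_nat k) in rt y * rt y = y"
  shows "K_fun rt \<alpha> \<beta> \<gamma> \<delta> n lam =
    S ^ part_size n lam *
    (\<Prod>z\<in>young n lam. x + of_nat (hook n lam z) - 1) *
    (\<Prod>i=1..n - 1. \<Prod>j=i + 1..n.
      ((x + of_nat (lam i) - of_nat (lam j) + of_nat j - of_nat i - 1) *
       (of_nat (lam i) - of_nat (lam j) + of_nat j - of_nat i)) /
      ((x + of_nat j - of_nat i - 1) * (of_nat j - of_nat i)))"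
proof -
  define L where "L k = lam k + (n - k)" for k
  define c where "c = (\<Prod>j<n. S ^ (n - Suc j))"
  have S_nz: "S \<noteq> 0" using nz by (simp add: S_def S_par_def)
  have c_nz: "c \<noteq> 0" by (simp add: c_def S_nz)
  have lam_mono: "lam b \<le> lam a" if "1 \<le> a" "a \<le> b" "b \<le> n" for a b
    using part that unfolding is_partition_def by blast
  have Z: "Z_fun rt \<alpha> \<beta> \<gamma> \<delta> N = S ^ N * pochhammer x N" for N
    unfolding x_def S_def
    by (rule Z_fun_eq_pochhammer) (use nz x_nz rt in \<open>auto simp: x_def\<close>)
  have det: "det (mat n n (\<lambda>(i, j). Z_fun rt \<alpha> \<beta> \<gamma> \<delta> (f (Suc i) + (n - Suc j)))) =
      c * (\<Prod>i=1..n. S ^ f i * pochhammer x (f i) * (\<Prod>k=i+1..n. of_nat (f i) - of_nat (f k)))" for f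
  proof -
    have inner: "(\<Prod>k\<in>{Suc i..<n}. of_nat (f (Suc i)) - of_nat (f (Suc k)) :: 'a) =
        (\<Prod>k=Suc i + 1..n. of_nat (f (Suc i)) - of_nat (f k))" for i
      using prod.shift_bounds_Suc_ivl[of "\<lambda>k. of_nat (f (Suc i)) - of_nat (f k) :: 'a" "Suc i" n]
      by (simp add: atLeastLessThanSuc_atLeastAtMost)
    show ?thesis
      unfolding Z
      by (subst det_power_mult_pochhammer)
        (simp add: inner[simplified] c_def prod.distrib prod.atLeast1_atMost_eq mult_ac)
  qed
  define Hk where "Hk i = (\<Prod>j=1..lam i. x + of_nat (hook n lam (i, j)) - 1)" for i
  define E where "E i = (\<Prod>k=i+1..n. x + of_nat (L i - L k) - 1)" for i
  define E0 where "E0 i = (\<Prod>k=i+1..n. x + of_nat (k - i) - 1)" for i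
  define F where "F i = (\<Prod>k=i+1..n. of_nat (L i) - of_nat (L k) :: 'a)" for i
  define F0 where "F0 i = (\<Prod>k=i+1..n. of_nat (n - i) - of_nat (n - k) :: 'a)" for i
  have poch: "pochhammer x (L i) = Hk i * E i" if "i \<in> {1..n}" for i
    using pochhammer_eq_prod_hooks[OF part, of i x] that by (simp add: Hk_def E_def L_def)
  have poch0: "pochhammer x (n - i) = E0 i" if "i \<in> {1..n}" for i
    using pochhammer_eq_prod_hooks[of n "\<lambda>_. 0" i x] that
    by (auto simp: E0_def is_partition_def intro!: prod.cong)
  have E0_nz: "E0 i \<noteq> 0" for i
  proof -
    have "x + of_nat (k - i) - 1 \<noteq> 0" if "k \<in> {i+1..n}" for k
      using x_nz[of "k - i - 1"] that by (auto simp: of_nat_diff algebra_simps)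
    then show ?thesis by (simp add: E0_def)
  qed
  have F0_nz: "F0 i \<noteq> 0" for i
    by (auto simp: F0_def)
  have row: "S ^ L i * pochhammer x (L i) * F i / (S ^ (n - i) * pochhammer x (n - i) * F0 i) =
      S ^ lam i * Hk i * (E i * F i / (E0 i * F0 i))" if "i \<in> {1..n}" for i
    using E0_nz[of i] F0_nz[of i] S_nz unfolding poch[OF that] poch0[OF that]
    by (simp add: L_def power_add field_simps)
  have quot: "E i * F i / (E0 i * F0 i) = (\<Prod>j=i + 1..n.
      ((x + of_nat (lam i) - of_nat (lam j) + of_nat j - of_nat i - 1) *
       (of_nat (lam i) - of_nat (lam j) + of_nat j - of_nat i)) /
      ((x + of_nat j - of_nat i - 1) * (of_nat j - of_nat i)))" if i: "1 \<le> i" for i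
    unfolding E_def F_def E0_def F0_def prod.distrib[symmetric] prod_dividef[symmetric]
  proof (rule prod.cong[OF refl])
    fix j assume j: "j \<in> {i+1..n}"
    then have "lam j \<le> lam i" using lam_mono[of i j] i by simp
    then have *: "of_nat (L i - L j) = (of_nat (lam i) - of_nat (lam j) + of_nat j - of_nat i :: 'a)"
      "of_nat (L i) - of_nat (L j) = (of_nat (lam i) - of_nat (lam j) + of_nat j - of_nat i :: 'a)"
      "of_nat (j - i) = (of_nat j - of_nat i :: 'a)"
      "of_nat (n - i) - of_nat (n - j) = (of_nat j - of_nat i :: 'a)"
      using j by (auto simp: L_def of_nat_diff)
    show "(x + of_nat (L i - L j) - 1) * (of_nat (L i) - of_nat (L j)) /
        ((x + of_nat (j - i) - 1) * (of_nat (n - i) - of_nat (n - j))) =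
      ((x + of_nat (lam i) - of_nat (lam j) + of_nat j - of_nat i - 1) *
       (of_nat (lam i) - of_nat (lam j) + of_nat j - of_nat i)) /
      ((x + of_nat j - of_nat i - 1) * (of_nat j - of_nat i))"
      unfolding * by (simp add: algebra_simps)
  qed
  have young: "(\<Prod>z\<in>young n lam. x + of_nat (hook n lam z) - 1) = (\<Prod>i=1..n. Hk i)"
  proof -
    have "young n lam = (SIGMA i:{1..n}. {1..lam i})" by (auto simp: young_def)
    then show ?thesis by (simp add: Hk_def prod.Sigma case_prod_unfold)
  qed
  have "K_fun rt \<alpha> \<beta> \<gamma> \<delta> n lam =
      (c * (\<Prod>i=1..n. S ^ L i * pochhammer x (L i) * F i)) /
      (c * (\<Prod>i=1..n. S ^ (n - i) * pochhammer x (n - i) * F0 i))"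
    using det[of L] det[of "\<lambda>i. n - i"] by (simp add: K_fun_def L_def F_def F0_def)
  also have "\<dots> = (\<Prod>i=1..n. S ^ L i * pochhammer x (L i) * F i / (S ^ (n - i) * pochhammer x (n - i) * F0 i))"
    using c_nz by (simp add: prod_dividef)
  also have "\<dots> = (\<Prod>i=1..n. S ^ lam i * Hk i * (E i * F i / (E0 i * F0 i)))"
    by (rule prod.cong[OF refl row])
  also have "\<dots> = S ^ part_size n lam * (\<Prod>i=1..n. Hk i) * (\<Prod>i=1..n. E i * F i / (E0 i * F0 i))"
    by (simp only: prod.distrib part_size_def power_sum)
  also have "(\<Prod>i=1..n. E i * F i / (E0 i * F0 i)) = (\<Prod>i=1..n - 1. E i * F i / (E0 i * F0 i))"
    by (rule prod.mono_neutral_right) (auto simp: E_def F_def E0_def F0_def)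
  finally show ?thesis
    by (simp add: young quot)
qed

theorem theorem8p5:
  fixes n :: nat and lam :: "nat \<Rightarrow> nat"
  assumes "is_partition n lam"
  shows "(\<forall>\<alpha> \<beta> \<gamma> \<delta> :: real.
          \<alpha> > 0 \<and> \<beta> > 0 \<and> \<gamma> > 0 \<and> \<delta> > 0 \<and> \<alpha> * \<beta> \<noteq> \<gamma> * \<delta> \<longrightarrow>
          (let x = x_par \<alpha> \<beta> \<gamma> \<delta>; S = S_par \<alpha> \<beta> \<gamma> \<delta> in
           K_fun sqrt \<alpha> \<beta> \<gamma> \<delta> n lam =
             S ^ part_size n lam *
             (\<Prod>z\<in>young n lam. x + of_nat (hook n lam z) - 1) *
             (\<Prod>i=1..n - 1. \<Prod>j=i + 1..n.
                ((x + of_nat (lam i) - of_nat (lam j) + of_nat j - of_nat i - 1) *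
                 (of_nat (lam i) - of_nat (lam j) + of_nat j - of_nat i)) /
                ((x + of_nat j - of_nat i - 1) * (of_nat j - of_nat i))))) \<and>
         (\<forall>\<alpha> \<beta> \<gamma> \<delta> :: complex.
          \<alpha> + \<gamma> \<noteq> 0 \<and> \<beta> + \<delta> \<noteq> 0 \<and> \<alpha> * \<beta> \<noteq> \<gamma> * \<delta> \<and>
          (\<forall>k::nat. x_par \<alpha> \<beta> \<gamma> \<delta> + of_nat k \<noteq> 0) \<longrightarrow>
          (let x = x_par \<alpha> \<beta> \<gamma> \<delta>; S = S_par \<alpha> \<beta> \<gamma> \<delta> in
           K_fun csqrt \<alpha> \<beta> \<gamma> \<delta> n lam =
             S ^ part_size n lam *
             (\<Prod>z\<in>young n lam. x + of_nat (hook n lam z) - 1) *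
             (\<Prod>i=1..n - 1. \<Prod>j=i + 1..n.
                ((x + of_nat (lam i) - of_nat (lam j) + of_nat j - of_nat i - 1) *
                 (of_nat (lam i) - of_nat (lam j) + of_nat j - of_nat i)) /
                ((x + of_nat j - of_nat i - 1) * (of_nat j - of_nat i)))))"
proof (intro conjI allI impI, goal_cases)
  case (1 \<alpha> \<beta> \<gamma> \<delta>)
  then have x: "x_par \<alpha> \<beta> \<gamma> \<delta> > 0"
    by (simp add: x_par_def)
  then have "x_par \<alpha> \<beta> \<gamma> \<delta> + of_nat k \<noteq> 0" for k
    by (smt (verit) of_nat_0_le_iff)
  with 1 x show ?case
    unfolding Let_def by (intro K_fun_eq_hook_product assms) auto
next
  case (2 \<alpha> \<beta> \<gamma> \<delta>)
  then show ?case
    unfolding Let_def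
    by (intro K_fun_eq_hook_product assms)
      (auto simp: Let_def power2_eq_square[symmetric])
qed

end
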